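(* Let $C_1$ (resp. $C'_1$) be the classical crystal of all equivalence classes of Young columns for $U_q(D_4^{(3)})$ (resp. $U_q(G_2^{(1)})$), and let $B_1$ (resp. $B'_1$) be the level-1 perfect crystal of $U_q(D_4^{(3)})$ (resp. $U_q(G_2^{(1)})$). Then the map $$\psi:C_1\to B_1,\quad c_i\mapsto u_i,\qquad i\in\{1,2,3,0,\bar3,\bar2,\bar1,\phi\},$$ (resp. the map $$\psi':C'_1\to B'_1,\quad c'_i\mapsto v_i,\qquad i\in\{1,2,3,4,5,6,7,0,\bar7,\bar6,\bar5,\bar4,\bar3,\bar2,\bar1\})$$ is a crystal isomorphism.
   Context: $I=\{0,1,2\}$, $\Lambda_i$ are the fundamental weights. A crystal isomorphism is a bijection (extended by $0\mapsto0$) preserving $\mathrm{wt},\varepsilon_i,\varphi_i$ and commuting with $\tilde e_i,\tilde f_i$ for all $i\in I$. **The perfect crystals.** $B_1=\{u_1,u_2,u_3,u_0,u_{\bar3},u_{\bar2},u_{\bar1},u_\phi\}$ with crystal graph ($b\xrightarrow{i}b'$ means $\tilde f_ib=b'$; $\tilde f_ib=0$ if no $i$-arrow leaves $b$): $1$-arrows $u_1\to u_2$, $u_3\to u_0\to u_{\bar3}$, $u_{\bar2}\to u_{\bar1}$; $2$-arrows $u_2\to u_3$, $u_{\bar3}\to u_{\bar2}$; $0$-arrows $u_{\bar1}\to u_\phi\to u_1$, $u_{\bar3}\to u_2$, $u_{\bar2}\to u_3$. $B'_1=\{v_0,v_1,\dots,v_7,v_{\bar1},\dots,v_{\bar7}\}$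 with crystal graph: $1$-arrows $v_1\to v_2$, $v_4\to v_5$, $v_6\to v_7\to v_{\bar6}$, $v_{\bar5}\to v_{\bar4}$, $v_{\bar2}\to v_{\bar1}$; $2$-arrows $v_2\to v_3\to v_4\to v_6$, $v_5\to v_{\bar7}\to v_{\bar5}$, $v_{\bar6}\to v_{\bar4}\to v_{\bar3}\to v_{\bar2}$; $0$-arrows $v_{\bar1}\to v_0\to v_1$, $v_{\bar6}\to v_2$, $v_{\bar4}\to v_3$, $v_{\bar3}\to v_4$, $v_{\bar2}\to v_6$. In both, $\varepsilon_i(b)=\max\{k:\tilde e_i^kb\ne0\}$, $\varphi_i(b)=\max\{k:\tilde f_i^kb\neq0\}$ and $\mathrm{wt}(b)=\sum_i(\varphi_i(b)-\varepsilon_i(b))\Lambda_i$. **Blocks (column pattern).** A column is built from colored blocks stacked in rows indexed by $\mathbb Z$ (the pictures of the paper encoded by labels; a label determines a position in the column). Type $D_4^{(3)}$: for each $n\in\mathbb Z$, row $2n$ contains a $0$-block $Z_n$ and a $2$-block $W_n$; row $2n+1$ contains two $1$-blocks $P_n$ (the one lying over $Z_n$) and $Q_n$ (the other one). Type $G_2^{(1)}$: for each $n\in\mathbb Z$, row $2n$ contains a $0$-block $Z_n$ and two $2$-blocks $A_n,B_n$ (with $B_n$ resting partly on $A_n$); row $2n+1$ contains two $1$-blocks $X_n,Y_n$ ($Y_n$ lying over $Z_n$) and a $2$-block $V_n$ lying on top of $Y_n$. Let $J_n$ be the set of all blocks in rows $\le 2n-1$. **Young columns.** These are exactly the following sets of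 blocks ($n\in\mathbb Z$ arbitrary). Type $D_4^{(3)}$: class $c_1$: $J_n\cup\{Z_n,W_n,Q_n,Z_{n+1}\}$; $c_2$: $J_n\cup\{Z_n\}$; $c_3$: $J_n\cup\{Z_n,W_n\}$; $c_0$: $J_n\cup\{Z_n,W_n,P_n\}$; $c_{\bar3}$: $J_n$; $c_{\bar2}$: $J_n\cup\{W_n\}$; $c_{\bar1}$: $J_n\cup\{W_n,Q_n\}$; $c_\phi$: $J_n\cup\{W_n,Q_n,Z_{n+1}\}$. Type $G_2^{(1)}$: $c'_1$: $J_n\cup\{Z_n,A_n,B_n,X_n,Z_{n+1}\}$; $c'_2$: $J_n\cup\{Z_n,A_n,B_n,X_n,Y_n,Z_{n+1}\}$; $c'_3$: $J_n\cup\{Z_n\}$; $c'_4$: $J_n\cup\{Z_n,A_n\}$; $c'_5$: $J_n\cup\{Z_n,A_n,Y_n\}$; $c'_6$: $J_n\cup\{Z_n,A_n,B_n\}$; $c'_7$: $J_n\cup\{Z_n,A_n,B_n,Y_n\}$; $c'_{\bar7}$: $J_n\cup\{Z_n,A_n,Y_n,V_n\}$; $c'_{\bar6}$: $J_n\cup\{Z_n,A_n,B_n,Y_n,X_n\}$; $c'_{\bar5}$: $J_n\cup\{Z_n,A_n,B_n,Y_n,V_n\}$; $c'_{\bar4}$: $J_n$; $c'_{\bar3}$: $J_n\cup\{A_n\}$; $c'_{\bar2}$: $J_n\cup\{A_n,B_n\}$; $c'_{\bar1}$: $J_n\cup\{A_n,B_n,X_n\}$; $c'_0$: $J_n\cup\{A_n,B_n,X_n,Z_{n+1}\}$.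 Two Young columns are equivalent iff they have the same class name (differ by a shift of $n$; geometrically, up to vertical position and $180^\circ$ horizontal rotation). $C_1$ (resp. $C'_1$) is the set of the 8 (resp. 15) classes. **Crystal structure on $C_1$, $C'_1$.** $\tilde f_i$ (resp. $\tilde e_i$) sends the class of a Young column $y$ to the class of the Young column obtained by adding (resp. removing) a single $i$-block, and to $0$ if this is impossible; by convention, in type $G_2^{(1)}$ no $2$-block may be added to or removed from a column of class $c'_7$, and no $2$-block may be added or removed so as to reach a column of class $c'_7$. $\varepsilon_i(y)=r$ and $\varphi_i(y)=a$, where $r$ is the number of removable and second removable $i$-blocks and $a$ the number of admissible and second admissible $i$-slots of $y$; $\mathrm{wt}(y)=\sum_i(\varphi_i(y)-\varepsilon_i(y))\Lambda_i$. Explicitly, the pairs $(r,a)$ are (pairs not listed are $(0,0)$): $D_4^{(3)}$, classes by subscript. $i=0$: $1:(2,0)$; $2,3:(1,0)$; $\bar3,\bar2:(0,1)$; $\bar1:(0,2)$; $\phi:(1,1)$. $i=1$: $1:(0,1)$; $2:(1,0)$; $3:(0,2)$; $0:(1,1)$; $\bar3:(2,0)$; $\bar2:(0,1)$; $\bar1:(1,0)$. $i=2$: $2:(0,1)$; $3:(1,0)$; $\bar3:(0,1)$; $\bar2:(1,0)$. $G_2^{(1)}$. $i=0$: $1:(2,0)$; $2,3,4,6:(1,0)$; $\bar6,\bar4,\bar3,\bar2:(0,1)$; $\bar1:(0,2)$; $0:(1,1)$. $i=1$: $1:(0,1)$; $2:(1,0)$; $4:(0,1)$; $5:(1,0)$;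 $6:(0,2)$; $7:(1,1)$; $\bar6:(2,0)$; $\bar5:(0,1)$; $\bar4:(1,0)$; $\bar2:(0,1)$; $\bar1:(1,0)$. $i=2$: $2:(0,3)$; $3:(1,2)$; $4:(2,1)$; $6:(3,0)$; $5:(0,2)$; $\bar7:(1,1)$; $\bar5:(2,0)$; $\bar6:(0,3)$; $\bar4:(1,2)$; $\bar3:(2,1)$; $\bar2:(3,0)$. *)

theory Defs
  imports Main
begin

section \<open>Crystals and crystal isomorphisms\<close>

definition Idx :: "nat set" where
  "Idx = {0, 1, 2}"

text \<open>A classical weight is given by its coordinates in the basis of fundamental weights.\<close>

type_synonym weight = "nat \<Rightarrow> int"

definition Lambda :: "nat \<Rightarrow> weight" where
  "Lambda i = (\<lambda>j. if j = i then 1 else 0)"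

definition weight_of :: "(nat \<Rightarrow> nat) \<Rightarrow> (nat \<Rightarrow> nat) \<Rightarrow> weight" where
  "weight_of ep ph = (\<lambda>j. \<Sum>i\<in>Idx. (int (ph i) - int (ep i)) * Lambda i j)"

text \<open>The element \<open>0\<close> adjoined to a crystal is \<^const>\<open>None\<close>.\<close>

record 'b crystal =
  elems :: "'b set"
  wt :: "'b \<Rightarrow> weight"
  eps :: "nat \<Rightarrow> 'b \<Rightarrow> nat"
  phi :: "nat \<Rightarrow> 'b \<Rightarrow> nat"
  e_op :: "nat \<Rightarrow> 'b \<Rightarrow> 'b option"
  f_op :: "nat \<Rightarrow> 'b \<Rightarrow> 'b option"

text \<open>The use of \<^const>\<open>map_option\<close> expresses that the map is extended by \<open>0 \<mapsto> 0\<close>.\<close>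

definition crystal_isomorphism :: "'b crystal \<Rightarrow> 'c crystal \<Rightarrow> ('b \<Rightarrow> 'c) \<Rightarrow> bool" where
  "crystal_isomorphism B C h \<longleftrightarrow>
     bij_betw h (elems B) (elems C) \<and>
     (\<forall>b\<in>elems B. wt C (h b) = wt B b) \<and>
     (\<forall>i\<in>Idx. \<forall>b\<in>elems B.
        eps C i (h b) = eps B i b \<and>
        phi C i (h b) = phi B i b \<and>
        e_op C i (h b) = map_option h (e_op B i b) \<and>
        f_op C i (h b) = map_option h (f_op B i b))"


section \<open>The crystal of a crystal graph\<close>

text \<open>\<open>(b, b') \<in> E i\<close> means that there is an \<open>i\<close>-arrow from \<open>b\<close> to \<open>b'\<close>.\<close>

definition graph_f :: "(nat \<Rightarrow> ('v \<times> 'v) set) \<Rightarrow> nat \<Rightarrow> 'v \<Rightarrow> 'v option" where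
  "graph_f E i b = (if \<exists>b'. (b, b') \<in> E i then Some (THE b'. (b, b') \<in> E i) else None)"

definition graph_e :: "(nat \<Rightarrow> ('v \<times> 'v) set) \<Rightarrow> nat \<Rightarrow> 'v \<Rightarrow> 'v option" where
  "graph_e E i b = (if \<exists>b'. (b', b) \<in> E i then Some (THE b'. (b', b) \<in> E i) else None)"

definition op_power :: "('v \<Rightarrow> 'v option) \<Rightarrow> nat \<Rightarrow> 'v \<Rightarrow> 'v option" where
  "op_power g k b = ((\<lambda>x. Option.bind x g) ^^ k) (Some b)"

definition string_length :: "('v \<Rightarrow> 'v option) \<Rightarrow> 'v \<Rightarrow> nat" where
  "string_length g b = Max {k. op_power g k b \<noteq> None}"

definition graph_crystal :: "(nat \<Rightarrow> ('v \<times> 'v) set) \<Rightarrow> 'v set \<Rightarrow> 'v crystal" where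
  "graph_crystal E V =
     \<lparr>elems = V,
      wt = (\<lambda>b. weight_of (\<lambda>i. string_length (graph_e E i) b) (\<lambda>i. string_length (graph_f E i) b)),
      eps = (\<lambda>i. string_length (graph_e E i)),
      phi = (\<lambda>i. string_length (graph_f E i)),
      e_op = graph_e E,
      f_op = graph_f E\<rparr>"


section \<open>Classes of columns and their crystal\<close>

text \<open>
  A column pattern with blocks of type \<open>'b\<close> is given by \<open>row\<close> and \<open>colour\<close>; its Young columns are
  the sets \<open>col l n\<close>, where \<open>l\<close> is the name of the class and \<open>n\<close> the vertical shift.
\<close>

definition blocks_below :: "('b \<Rightarrow> int) \<Rightarrow> int \<Rightarrow> 'b set" where
  "blocks_below row n = {b. row b \<le> 2 * n - 1}"

definition young_columns :: "('l \<Rightarrow> int \<Rightarrow> 'b set) \<Rightarrow> 'b set set" where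
  "young_columns col = {y. \<exists>l n. y = col l n}"

definition column_equiv :: "('l \<Rightarrow> int \<Rightarrow> 'b set) \<Rightarrow> ('b set \<times> 'b set) set" where
  "column_equiv col = {(y, y'). \<exists>l n m. y = col l n \<and> y' = col l m}"

definition column_classes :: "('l \<Rightarrow> int \<Rightarrow> 'b set) \<Rightarrow> 'b set set set" where
  "column_classes col = young_columns col // column_equiv col"

definition class_of :: "('l \<Rightarrow> int \<Rightarrow> 'b set) \<Rightarrow> 'l \<Rightarrow> 'b set set" where
  "class_of col l = {y. \<exists>n. y = col l n}"

definition class_name :: "('l \<Rightarrow> int \<Rightarrow> 'b set) \<Rightarrow> 'b set set \<Rightarrow> 'l" where
  "class_name col K = (THE l. K = class_of col l)"

text \<open>
  \<open>adds\<close>: the column \<open>y'\<close> arises from \<open>y\<close> by adding a single \<open>i\<close>-block, where \<open>ban\<close> records the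
  additions that are excluded by convention. Removing a block is the converse relation.
\<close>

definition adds ::
  "('b \<Rightarrow> nat) \<Rightarrow> (nat \<Rightarrow> 'b set \<Rightarrow> 'b set \<Rightarrow> bool) \<Rightarrow> nat \<Rightarrow> 'b set \<Rightarrow> 'b set \<Rightarrow> bool" where
  "adds colour ban i y y' \<longleftrightarrow>
     (\<exists>b. colour b = i \<and> b \<notin> y \<and> y' = insert b y) \<and> \<not> ban i y y'"

definition class_adds ::
  "('b \<Rightarrow> nat) \<Rightarrow> (nat \<Rightarrow> 'b set \<Rightarrow> 'b set \<Rightarrow> bool) \<Rightarrow> nat \<Rightarrow> 'b set set \<Rightarrow> 'b set set \<Rightarrow> bool" where
  "class_adds colour ban i K K' \<longleftrightarrow> (\<exists>y\<in>K. \<exists>y'\<in>K'. adds colour ban i y y')"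

definition column_f ::
  "('l \<Rightarrow> int \<Rightarrow> 'b set) \<Rightarrow> ('b \<Rightarrow> nat) \<Rightarrow> (nat \<Rightarrow> 'b set \<Rightarrow> 'b set \<Rightarrow> bool) \<Rightarrow>
     nat \<Rightarrow> 'b set set \<Rightarrow> 'b set set option" where
  "column_f col colour ban i K =
     (if \<exists>K'\<in>column_classes col. class_adds colour ban i K K'
      then Some (THE K'. K' \<in> column_classes col \<and> class_adds colour ban i K K')
      else None)"

definition column_e ::
  "('l \<Rightarrow> int \<Rightarrow> 'b set) \<Rightarrow> ('b \<Rightarrow> nat) \<Rightarrow> (nat \<Rightarrow> 'b set \<Rightarrow> 'b set \<Rightarrow> bool) \<Rightarrow>
     nat \<Rightarrow> 'b set set \<Rightarrow> 'b set set option" where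
  "column_e col colour ban i K =
     (if \<exists>K'\<in>column_classes col. class_adds colour ban i K' K
      then Some (THE K'. K' \<in> column_classes col \<and> class_adds colour ban i K' K)
      else None)"

text \<open>
  \<open>sig i l = (r, a)\<close>, where \<open>r\<close> is the number of removable and second removable \<open>i\<close>-blocks and \<open>a\<close>
  the number of admissible and second admissible \<open>i\<close>-slots of a column of class \<open>l\<close>.
\<close>

definition column_crystal ::
  "('l \<Rightarrow> int \<Rightarrow> 'b set) \<Rightarrow> ('b \<Rightarrow> nat) \<Rightarrow> (nat \<Rightarrow> 'b set \<Rightarrow> 'b set \<Rightarrow> bool) \<Rightarrow>
     (nat \<Rightarrow> 'l \<Rightarrow> nat \<times> nat) \<Rightarrow> 'b set set crystal" where
  "column_crystal col colour ban sig =
     \<lparr>elems = column_classes col,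
      wt = (\<lambda>K. weight_of (\<lambda>i. fst (sig i (class_name col K))) (\<lambda>i. snd (sig i (class_name col K)))),
      eps = (\<lambda>i K. fst (sig i (class_name col K))),
      phi = (\<lambda>i K. snd (sig i (class_name col K))),
      e_op = column_e col colour ban,
      f_op = column_f col colour ban\<rparr>"


section \<open>Type \<open>D\<^sub>4\<^sup>(\<^sup>3\<^sup>)\<close>\<close>

text \<open>The suffix \<open>b\<close> stands for a bar over the index.\<close>

datatype d_label = D1 | D2 | D3 | D0 | D3b | D2b | D1b | Dphi

datatype d_vertex = U d_label

definition d_arrows :: "nat \<Rightarrow> (d_vertex \<times> d_vertex) set" where
  "d_arrows i =
     (if i = 0 then {(U D1b, U Dphi), (U Dphi, U D1), (U D3b, U D2), (U D2b, U D3)}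
      else if i = 1 then {(U D1, U D2), (U D3, U D0), (U D0, U D3b), (U D2b, U D1b)}
      else if i = 2 then {(U D2, U D3), (U D3b, U D2b)}
      else {})"

definition B1 :: "d_vertex crystal" where
  "B1 = graph_crystal d_arrows UNIV"

datatype d_block = DZ int | DW int | DP int | DQ int

primrec d_row :: "d_block \<Rightarrow> int" where
  "d_row (DZ n) = 2 * n"
| "d_row (DW n) = 2 * n"
| "d_row (DP n) = 2 * n + 1"
| "d_row (DQ n) = 2 * n + 1"

primrec d_colour :: "d_block \<Rightarrow> nat" where
  "d_colour (DZ n) = 0"
| "d_colour (DW n) = 2"
| "d_colour (DP n) = 1"
| "d_colour (DQ n) = 1"

primrec d_col :: "d_label \<Rightarrow> int \<Rightarrow> d_block set" where
  "d_col D1 n = blocks_below d_row n \<union> {DZ n, DW n, DQ n, DZ (n + 1)}"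
| "d_col D2 n = blocks_below d_row n \<union> {DZ n}"
| "d_col D3 n = blocks_below d_row n \<union> {DZ n, DW n}"
| "d_col D0 n = blocks_below d_row n \<union> {DZ n, DW n, DP n}"
| "d_col D3b n = blocks_below d_row n"
| "d_col D2b n = blocks_below d_row n \<union> {DW n}"
| "d_col D1b n = blocks_below d_row n \<union> {DW n, DQ n}"
| "d_col Dphi n = blocks_below d_row n \<union> {DW n, DQ n, DZ (n + 1)}"

definition d_sig :: "nat \<Rightarrow> d_label \<Rightarrow> nat \<times> nat" where
  "d_sig i l =
     (if i = 0 then
        (case l of D1 \<Rightarrow> (2, 0) | D2 \<Rightarrow> (1, 0) | D3 \<Rightarrow> (1, 0) | D3b \<Rightarrow> (0, 1) | D2b \<Rightarrow> (0, 1)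
           | D1b \<Rightarrow> (0, 2) | Dphi \<Rightarrow> (1, 1) | _ \<Rightarrow> (0, 0))
      else if i = 1 then
        (case l of D1 \<Rightarrow> (0, 1) | D2 \<Rightarrow> (1, 0) | D3 \<Rightarrow> (0, 2) | D0 \<Rightarrow> (1, 1) | D3b \<Rightarrow> (2, 0)
           | D2b \<Rightarrow> (0, 1) | D1b \<Rightarrow> (1, 0) | _ \<Rightarrow> (0, 0))
      else if i = 2 then
        (case l of D2 \<Rightarrow> (0, 1) | D3 \<Rightarrow> (1, 0) | D3b \<Rightarrow> (0, 1) | D2b \<Rightarrow> (1, 0) | _ \<Rightarrow> (0, 0))
      else (0, 0))"

definition C1 :: "d_block set set crystal" where
  "C1 = column_crystal d_col d_colour (\<lambda>i y y'. False) d_sig"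

definition d_class :: "d_label \<Rightarrow> d_block set set" where
  "d_class = class_of d_col"

definition psi :: "d_block set set \<Rightarrow> d_vertex" where
  "psi K = U (THE l. K = d_class l)"


section \<open>Type \<open>G\<^sub>2\<^sup>(\<^sup>1\<^sup>)\<close>\<close>

datatype g_label =
    G1 | G2 | G3 | G4 | G5 | G6 | G7 | G0 | G7b | G6b | G5b | G4b | G3b | G2b | G1b

datatype g_vertex = V g_label

definition g_arrows :: "nat \<Rightarrow> (g_vertex \<times> g_vertex) set" where
  "g_arrows i =
     (if i = 0 then
        {(V G1b, V G0), (V G0, V G1), (V G6b, V G2), (V G4b, V G3), (V G3b, V G4), (V G2b, V G6)}
      else if i = 1 then
        {(V G1, V G2), (V G4, V G5), (V G6, V G7), (V G7, V G6b), (V G5b, V G4b), (V G2b, V G1b)}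
      else if i = 2 then
        {(V G2, V G3), (V G3, V G4), (V G4, V G6), (V G5, V G7b), (V G7b, V G5b),
         (V G6b, V G4b), (V G4b, V G3b), (V G3b, V G2b)}
      else {})"

definition B1' :: "g_vertex crystal" where
  "B1' = graph_crystal g_arrows UNIV"

datatype g_block = GZ int | GA int | GB int | GX int | GY int | GV int

primrec g_row :: "g_block \<Rightarrow> int" where
  "g_row (GZ n) = 2 * n"
| "g_row (GA n) = 2 * n"
| "g_row (GB n) = 2 * n"
| "g_row (GX n) = 2 * n + 1"
| "g_row (GY n) = 2 * n + 1"
| "g_row (GV n) = 2 * n + 1"

primrec g_colour :: "g_block \<Rightarrow> nat" where
  "g_colour (GZ n) = 0"
| "g_colour (GA n) = 2"
| "g_colour (GB n) = 2"
| "g_colour (GX n) = 1"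
| "g_colour (GY n) = 1"
| "g_colour (GV n) = 2"

primrec g_col :: "g_label \<Rightarrow> int \<Rightarrow> g_block set" where
  "g_col G1 n = blocks_below g_row n \<union> {GZ n, GA n, GB n, GX n, GZ (n + 1)}"
| "g_col G2 n = blocks_below g_row n \<union> {GZ n, GA n, GB n, GX n, GY n, GZ (n + 1)}"
| "g_col G3 n = blocks_below g_row n \<union> {GZ n}"
| "g_col G4 n = blocks_below g_row n \<union> {GZ n, GA n}"
| "g_col G5 n = blocks_below g_row n \<union> {GZ n, GA n, GY n}"
| "g_col G6 n = blocks_below g_row n \<union> {GZ n, GA n, GB n}"
| "g_col G7 n = blocks_below g_row n \<union> {GZ n, GA n, GB n, GY n}"
| "g_col G7b n = blocks_below g_row n \<union> {GZ n, GA n, GY n, GV n}"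
| "g_col G6b n = blocks_below g_row n \<union> {GZ n, GA n, GB n, GY n, GX n}"
| "g_col G5b n = blocks_below g_row n \<union> {GZ n, GA n, GB n, GY n, GV n}"
| "g_col G4b n = blocks_below g_row n"
| "g_col G3b n = blocks_below g_row n \<union> {GA n}"
| "g_col G2b n = blocks_below g_row n \<union> {GA n, GB n}"
| "g_col G1b n = blocks_below g_row n \<union> {GA n, GB n, GX n}"
| "g_col G0 n = blocks_below g_row n \<union> {GA n, GB n, GX n, GZ (n + 1)}"

definition g_sig :: "nat \<Rightarrow> g_label \<Rightarrow> nat \<times> nat" where
  "g_sig i l =
     (if i = 0 then
        (case l of G1 \<Rightarrow> (2, 0) | G2 \<Rightarrow> (1, 0) | G3 \<Rightarrow> (1, 0) | G4 \<Rightarrow> (1, 0) | G6 \<Rightarrow> (1, 0)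
           | G6b \<Rightarrow> (0, 1) | G4b \<Rightarrow> (0, 1) | G3b \<Rightarrow> (0, 1) | G2b \<Rightarrow> (0, 1)
           | G1b \<Rightarrow> (0, 2) | G0 \<Rightarrow> (1, 1) | _ \<Rightarrow> (0, 0))
      else if i = 1 then
        (case l of G1 \<Rightarrow> (0, 1) | G2 \<Rightarrow> (1, 0) | G4 \<Rightarrow> (0, 1) | G5 \<Rightarrow> (1, 0) | G6 \<Rightarrow> (0, 2)
           | G7 \<Rightarrow> (1, 1) | G6b \<Rightarrow> (2, 0) | G5b \<Rightarrow> (0, 1) | G4b \<Rightarrow> (1, 0)
           | G2b \<Rightarrow> (0, 1) | G1b \<Rightarrow> (1, 0) | _ \<Rightarrow> (0, 0))
      else if i = 2 then
        (case l of G2 \<Rightarrow> (0, 3) | G3 \<Rightarrow> (1, 2) | G4 \<Rightarrow> (2, 1) | G6 \<Rightarrow> (3, 0)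
           | G5 \<Rightarrow> (0, 2) | G7b \<Rightarrow> (1, 1) | G5b \<Rightarrow> (2, 0)
           | G6b \<Rightarrow> (0, 3) | G4b \<Rightarrow> (1, 2) | G3b \<Rightarrow> (2, 1) | G2b \<Rightarrow> (3, 0) | _ \<Rightarrow> (0, 0))
      else (0, 0))"

definition g_class :: "g_label \<Rightarrow> g_block set set" where
  "g_class = class_of g_col"

text \<open>
  By convention no \<open>2\<close>-block is added to or removed from a column of class \<open>g_class G7\<close>, and no
  \<open>2\<close>-block is added or removed so as to reach such a column.
\<close>

definition g_ban :: "nat \<Rightarrow> g_block set \<Rightarrow> g_block set \<Rightarrow> bool" where
  "g_ban i y y' \<longleftrightarrow> i = 2 \<and> (y \<in> g_class G7 \<or> y' \<in> g_class G7)"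

definition C1' :: "g_block set set crystal" where
  "C1' = column_crystal g_col g_colour g_ban g_sig"

definition psi' :: "g_block set set \<Rightarrow> g_vertex" where
  "psi' K = V (THE l. K = g_class l)"

end

theory Submission
  imports Defs
begin

text \<open>
  The indices of the blocks of one kind (all the \<open>Z\<^sub>n\<close>, say) in a given Young column form an
  initial segment of the integers, possibly with the element just below the top one missing
  (this happens only for the \<open>Z\<^sub>n\<close> in the classes \<open>c\<^sub>\<phi>\<close> and \<open>c'\<^sub>0\<close>). Counting the blocks of each kind
  relative to a fixed level thus turns a column into a vector of integers. Shifting the column adds
  a constant to this vector, adding a block increases one entry by one, and the vector modulo
  constants determines the class. Which class arises from which by adding a block of a given colour
  thereby becomes a finite comparison of integer vectors, and the outcome is the crystal graph.
\<close>

section \<open>Crystals of crystal graphs\<close>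

lemma op_power_0: "op_power g 0 b = Some b"
  by (simp add: op_power_def)

lemma op_power_Suc: "op_power g (Suc k) b = Option.bind (op_power g k b) g"
  by (simp add: op_power_def)

text \<open>An iterate that reaches \<open>None\<close> stays \<open>None\<close>, so two
  consecutive iterates decide the length. The bound also gives the finiteness without which
  \<open>Max\<close> would be unspecified.\<close>

lemma string_length_eqI:
  assumes "op_power g k b \<noteq> None" and "op_power g (Suc k) b = None"
  shows "string_length g b = k"
proof -
  have none: "op_power g (Suc k + j) b = None" for j
    by (induction j) (use assms(2) in \<open>simp_all add: op_power_Suc\<close>)
  have le: "j \<le> k" if "op_power g j b \<noteq> None" for j
  proof (rule ccontr)
    assume "\<not> j \<le> k"
    then have "j = Suc k + (j - Suc k)" by simp
    with none[of "j - Suc k"] that show False by simp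
  qed
  then have "finite {j. op_power g j b \<noteq> None}"
    by (auto intro: finite_subset[of _ "{..k}"])
  with le assms(1) show ?thesis
    unfolding string_length_def by (intro Max_eqI) auto
qed


section \<open>Young columns as integer vectors\<close>

text \<open>A gap trades the top element \<open>h - 1\<close> for \<open>h\<close>. Thus
  \<open>h\<close> counts the elements relative to \<open>{..<0}\<close> in both cases.\<close>

definition slice :: "int \<Rightarrow> bool \<Rightarrow> int set" where
  "slice h gap = (if gap then insert h {..<h - 1} else {..<h})"

lemma slice_eq_iff: "slice h g = slice h' g' \<longleftrightarrow> h = h' \<and> g = g'"
proof
  assume eq: "slice h g = slice h' g'"
  have "j \<in> slice h g \<longleftrightarrow> j \<in> slice h' g'" for j
    using eq by simp
  \<comment> \<open>Gap and top lie within \<open>h - 2\<close> to \<open>h\<close>, so these six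
    membership tests separate distinct slices.\<close>
  from this[of h] this[of h'] this[of "h - 1"] this[of "h' - 1"] this[of "h - 2"] this[of "h' - 2"]
  show "h = h' \<and> g = g'"
    by (auto simp: slice_def split: if_splits)
qed simp

text \<open>One insertion either extends the segment, opens a gap by skipping \<open>h\<close>, or
  fills the gap at \<open>h - 1\<close>. It cannot fill one gap and open the next at once.\<close>

lemma slice_eq_insert_iff:
  "(j \<notin> slice h g \<and> slice h' g' = insert j (slice h g)) \<longleftrightarrow>
     h' = h + 1 \<and> \<not> (g \<and> g') \<and> j = (if g then h - 1 else if g' then h + 1 else h)"
  (is "?L \<longleftrightarrow> ?R")
proof
  assume L: ?L
  have "i \<in> slice h' g' \<longleftrightarrow> i = j \<or> i \<in> slice h g" for i
    using L by simp
  from this[of h'] this[of "h' - 1"] this[of h] this[of "h - 1"] this[of j] L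
  show ?R
    unfolding slice_def by (cases g; cases g') (simp_all, smt+)
next
  assume ?R
  then show ?L
    by (auto simp: slice_def)
qed

text \<open>Common frame for both types: \<open>kind\<close> is the letter of a block,
  \<open>index\<close> its subscript. The axiom \<open>height_shift\<close> lets the label be
  recovered once the vertical shift is forgotten.\<close>

locale column_pattern =
  fixes kind :: "'b \<Rightarrow> 'k" and index :: "'b \<Rightarrow> int" and block :: "'k \<Rightarrow> int \<Rightarrow> 'b"
    and height :: "'l \<Rightarrow> 'k \<Rightarrow> int" and gap :: "'l \<Rightarrow> 'k \<Rightarrow> bool" and col :: "'l \<Rightarrow> int \<Rightarrow> 'b set"
    and colour :: "'b \<Rightarrow> nat" and kind_colour :: "'k \<Rightarrow> nat"
  assumes kind_block [simp]: "kind (block k n) = k"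
    and index_block [simp]: "index (block k n) = n"
    and block_kind_index: "block (kind b) (index b) = b"
    and colour_eq: "colour b = kind_colour (kind b)"
    and col_eq: "col l n = {b. index b \<in> slice (n + height l (kind b)) (gap l (kind b))}"
    and height_shift: "(\<And>k. height l' k = height l k + d) \<Longrightarrow> l' = l"
begin

lemma slice_col: "{j. block k j \<in> col l n} = slice (n + height l k) (gap l k)"
  by (simp add: col_eq)

text \<open>The slices of a column determine its heights, so two descriptions of one column have
  height vectors differing by the constant \<open>m - n\<close>.\<close>

lemma col_label: "l = l'" if "col l n = col l' m"
proof -
  have "height l k = height l' k + (m - n)" for k
    using slice_col[of k l n] slice_col[of k l' m] that by (simp add: slice_eq_iff)
  then show ?thesis by (rule height_shift)
qed

lemma col_in_class_of: "col l n \<in> class_of col l' \<longleftrightarrow> l = l'"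
  using col_label by (auto simp: class_of_def)

lemma class_of_eq_iff: "class_of col l = class_of col l' \<longleftrightarrow> l = l'"
  using col_in_class_of by metis

lemma class_name_class_of: "class_name col (class_of col l) = l"
  by (simp add: class_name_def class_of_eq_iff)

lemma column_classes_eq: "column_classes col = range (class_of col)"
proof -
  have eq_class: "column_equiv col `` {col l n} = class_of col l" for l n
  proof (rule set_eqI)
    fix y
    show "y \<in> column_equiv col `` {col l n} \<longleftrightarrow> y \<in> class_of col l"
      unfolding column_equiv_def class_of_def by (auto dest!: col_label)
  qed
  have "column_classes col = (\<Union>l n. {column_equiv col `` {col l n}})"
    unfolding column_classes_def young_columns_def quotient_def by blast
  then show ?thesis
    by (auto simp: eq_class)
qed

text \<open>A new block affects only the slice of its own kind, so the claim splits into one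
  insertion into a slice and equalities of all the others.\<close>

lemma insert_col_iff:
  "(b \<notin> col l n \<and> col l' m = insert b (col l n)) \<longleftrightarrow>
     (\<forall>k. m + height l' k = n + height l k + (if k = kind b then 1 else 0)) \<and>
     (\<forall>k. k \<noteq> kind b \<longrightarrow> gap l' k = gap l k) \<and> \<not> (gap l (kind b) \<and> gap l' (kind b)) \<and>
     index b = n + height l (kind b) + (if gap l (kind b) then - 1 else if gap l' (kind b) then 1 else 0)"
  (is "?L \<longleftrightarrow> ?R")
proof -
  let ?S = "\<lambda>k. slice (n + height l k) (gap l k)" and ?S' = "\<lambda>k. slice (m + height l' k) (gap l' k)"
  have "b' = b \<longleftrightarrow> kind b = kind b' \<and> index b = index b'" for b'
    by (metis block_kind_index)
  then have "?L \<longleftrightarrow> index b \<notin> ?S (kind b) \<and>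
      (\<forall>b'. index b' \<in> ?S' (kind b') \<longleftrightarrow> kind b = kind b' \<and> index b = index b' \<or> index b' \<in> ?S (kind b'))"
    by (auto simp: col_eq set_eq_iff)
  \<comment> \<open>Blocks correspond bijectively to pairs of a kind and an index.\<close>
  also have "\<dots> \<longleftrightarrow> index b \<notin> ?S (kind b) \<and>
      (\<forall>k j. j \<in> ?S' k \<longleftrightarrow> kind b = k \<and> index b = j \<or> j \<in> ?S k)"
    by (metis kind_block index_block)
  also have "\<dots> \<longleftrightarrow> (index b \<notin> ?S (kind b) \<and> ?S' (kind b) = insert (index b) (?S (kind b))) \<and>
      (\<forall>k. k \<noteq> kind b \<longrightarrow> ?S' k = ?S k)"
    unfolding set_eq_iff insert_iff by metis
  also have "\<dots> \<longleftrightarrow> ?R"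
    unfolding slice_eq_insert_iff slice_eq_iff by auto
  finally show ?thesis .
qed

text \<open>The shifts of the two representatives enter only through their difference, the constant
  \<open>d\<close>. The ban has to be a condition on labels for this to pass to classes.\<close>

lemma class_adds_iff:
  assumes ban: "\<And>n m. ban i (col l n) (col l' m) \<longleftrightarrow> banned i l l'"
  shows "class_adds colour ban i (class_of col l) (class_of col l') \<longleftrightarrow>
     (\<exists>k d. kind_colour k = i \<and> (\<forall>k'. height l' k' = height l k' + (if k' = k then 1 else 0) + d) \<and>
       (\<forall>k'. k' \<noteq> k \<longrightarrow> gap l' k' = gap l k') \<and> \<not> (gap l k \<and> gap l' k)) \<and>
     \<not> banned i l l'"
    (is "?L \<longleftrightarrow> (\<exists>k d. ?P k d) \<and> ?B")
proof
  assume ?L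
  then obtain n m b where b: "colour b = i" "b \<notin> col l n" "col l' m = insert b (col l n)"
    and "\<not> ban i (col l n) (col l' m)"
    by (auto simp: class_adds_def adds_def class_of_def)
  note ins = conjI[OF b(2,3), unfolded insert_col_iff]
  have "height l' k = height l k + (if k = kind b then 1 else 0) + (n - m)" for k
    using ins[THEN conjunct1, rule_format, of k] by linarith
  then have "?P (kind b) (n - m)"
    using b(1) ins by (simp add: colour_eq)
  moreover have ?B
    using \<open>\<not> ban i (col l n) (col l' m)\<close> ban by simp
  ultimately show "(\<exists>k d. ?P k d) \<and> ?B" by blast
next
  assume "(\<exists>k d. ?P k d) \<and> ?B"
  then obtain k d where P: "?P k d" and ?B by blast
  \<comment> \<open>With representatives at shifts \<open>0\<close> and \<open>- d\<close>, this
    index is the one forced by \<open>insert_col_iff\<close>.\<close>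
  define b where "b = block k (height l k + (if gap l k then - 1 else if gap l' k then 1 else 0))"
  have "b \<notin> col l 0 \<and> col l' (- d) = insert b (col l 0)"
    using P by (subst insert_col_iff) (simp add: b_def)
  moreover have "colour b = i"
    using P by (simp add: colour_eq b_def)
  ultimately have "adds colour ban i (col l 0) (col l' (- d))"
    unfolding adds_def ban using \<open>?B\<close> by blast
  then show ?L
    by (auto simp: class_adds_def class_of_def)
qed

text \<open>Once block additions match arrows, single-valuedness in both directions makes every
  \<open>THE\<close> pick the corresponding class and vertex.\<close>

lemma crystal_isomorphism_graph_crystal:
  assumes v: "bij v"
    and h: "\<And>l. h (class_of col l) = v l"
    and adds: "\<And>i l l'. i \<in> Idx \<Longrightarrow>
      class_adds colour ban i (class_of col l) (class_of col l') \<longleftrightarrow> (v l, v l') \<in> E i"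
    and single: "\<And>i. i \<in> Idx \<Longrightarrow> single_valued (E i)" "\<And>i. i \<in> Idx \<Longrightarrow> single_valued ((E i)\<inverse>)"
    and sig: "\<And>i l. i \<in> Idx \<Longrightarrow>
      sig i l = (string_length (graph_e E i) (v l), string_length (graph_f E i) (v l))"
  shows "crystal_isomorphism (column_crystal col colour ban sig) (graph_crystal E UNIV) h"
proof -
  have ran: "b \<in> range v" for b
    using v by (simp add: bij_is_surj)
  have f: "graph_f E i (v l) = map_option h (column_f col colour ban i (class_of col l))"
    if i: "i \<in> Idx" for i l
  proof (cases "\<exists>l'. (v l, v l') \<in> E i")
    case True
    then obtain l' where l': "(v l, v l') \<in> E i" by blast
    have uniq: "l'' = l'" if "(v l, v l'') \<in> E i" for l''
      using single_valuedD[OF single(1)[OF i] that l'] v by (simp add: bij_is_inj inj_eq)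
    have "(THE K'. K' \<in> column_classes col \<and> class_adds colour ban i (class_of col l) K')
        = class_of col l'"
      using l' by (intro the_equality) (auto simp: column_classes_eq adds[OF i] dest: uniq)
    moreover have "(THE b'. (v l, b') \<in> E i) = v l'"
      using l' single(1)[OF i] by (intro the_equality) (auto dest: single_valuedD)
    ultimately show ?thesis
      using l' by (auto simp: graph_f_def column_f_def column_classes_eq adds[OF i] h)
  next
    case False
    \<comment> \<open>Surjectivity of \<open>v\<close> excludes arrows to any vertex, not just to
      those written as \<open>v l'\<close>.\<close>
    then have "(v l, b) \<notin> E i" for b using ran[of b] by auto
    with False show ?thesis
      by (simp add: graph_f_def column_f_def column_classes_eq adds[OF i])
  qed
  have e: "graph_e E i (v l) = map_option h (column_e col colour ban i (class_of col l))"
    if i: "i \<in> Idx" for i l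
  proof (cases "\<exists>l'. (v l', v l) \<in> E i")
    case True
    then obtain l' where l': "(v l', v l) \<in> E i" by blast
    have uniq: "l'' = l'" if "(v l'', v l) \<in> E i" for l''
      using single_valuedD[OF single(2)[OF i] converseI[OF that] converseI[OF l']] v
      by (simp add: bij_is_inj inj_eq)
    have "(THE K'. K' \<in> column_classes col \<and> class_adds colour ban i K' (class_of col l))
        = class_of col l'"
      using l' by (intro the_equality) (auto simp: column_classes_eq adds[OF i] dest: uniq)
    moreover have "(THE b'. (b', v l) \<in> E i) = v l'"
      using l' single(2)[OF i] by (intro the_equality) (auto dest: single_valuedD)
    ultimately show ?thesis
      using l' by (auto simp: graph_e_def column_e_def column_classes_eq adds[OF i] h)
  next
    case False
    then have "(b, v l) \<notin> E i" for b using ran[of b] by auto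
    with False show ?thesis
      by (simp add: graph_e_def column_e_def column_classes_eq adds[OF i])
  qed
  have "inj_on h (range (class_of col))"
    using v by (auto simp: inj_on_def h dest: bij_is_inj injD)
  moreover have "h ` range (class_of col) = UNIV"
    using v by (auto simp: image_image h bij_is_surj)
  \<comment> \<open>Weights agree because \<open>weight_of\<close> sums over \<open>Idx\<close>
    only, where \<open>sig\<close> gives both string lengths.\<close>
  ultimately show ?thesis
    by (auto simp: crystal_isomorphism_def column_crystal_def graph_crystal_def bij_betw_def
        column_classes_eq class_name_class_of h e f sig weight_of_def intro!: sum.cong)
qed

end


section \<open>Type \<open>D\<^sub>4\<^sup>(\<^sup>3\<^sup>)\<close>\<close>

datatype d_kind = KZ | KW | KP | KQ

primrec d_kind_of :: "d_block \<Rightarrow> d_kind" where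
  "d_kind_of (DZ n) = KZ"
| "d_kind_of (DW n) = KW"
| "d_kind_of (DP n) = KP"
| "d_kind_of (DQ n) = KQ"

primrec d_index :: "d_block \<Rightarrow> int" where
  "d_index (DZ n) = n"
| "d_index (DW n) = n"
| "d_index (DP n) = n"
| "d_index (DQ n) = n"

primrec d_block_at :: "d_kind \<Rightarrow> int \<Rightarrow> d_block" where
  "d_block_at KZ = DZ"
| "d_block_at KW = DW"
| "d_block_at KP = DP"
| "d_block_at KQ = DQ"

primrec d_kind_colour :: "d_kind \<Rightarrow> nat" where
  "d_kind_colour KZ = 0"
| "d_kind_colour KW = 2"
| "d_kind_colour KP = 1"
| "d_kind_colour KQ = 1"

text \<open>Entries in the order \<open>KZ\<close>, \<open>KW\<close>, \<open>KP\<close>,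
  \<open>KQ\<close>. In \<open>Dphi\<close> the first is 1, not 2: the upper 0-block is present but
  the lower one is missing.\<close>

primrec d_height :: "d_label \<Rightarrow> d_kind \<Rightarrow> int" where
  "d_height D1 = case_d_kind 2 1 0 1"
| "d_height D2 = case_d_kind 1 0 0 0"
| "d_height D3 = case_d_kind 1 1 0 0"
| "d_height D0 = case_d_kind 1 1 1 0"
| "d_height D3b = case_d_kind 0 0 0 0"
| "d_height D2b = case_d_kind 0 1 0 0"
| "d_height D1b = case_d_kind 0 1 0 1"
| "d_height Dphi = case_d_kind 1 1 0 1"

text \<open>Heights alone would allow a 1-block to lead from \<open>D3\<close> to
  \<open>Dphi\<close> and from \<open>Dphi\<close> to \<open>D3b\<close>; the gap excludes
  both.\<close>

definition d_gap :: "d_label \<Rightarrow> d_kind \<Rightarrow> bool" where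
  "d_gap l k \<longleftrightarrow> l = Dphi \<and> k = KZ"

lemma all_d_kind: "(\<forall>k. P k) \<longleftrightarrow> P KZ \<and> P KW \<and> P KP \<and> P KQ"
  by (metis d_kind.exhaust)

lemma ex_d_kind: "(\<exists>k. P k) \<longleftrightarrow> P KZ \<or> P KW \<or> P KP \<or> P KQ"
  by (metis d_kind.exhaust)

interpretation d: column_pattern d_kind_of d_index d_block_at d_height d_gap d_col d_colour d_kind_colour
proof
  show "d_kind_of (d_block_at k n) = k" for k n by (cases k) simp_all
  show "d_index (d_block_at k n) = n" for k n by (cases k) simp_all
  show "d_block_at (d_kind_of b) (d_index b) = b" for b by (cases b) simp_all
  show "d_colour b = d_kind_colour (d_kind_of b)" for b by (cases b) simp_all
  show "d_col l n = {b. d_index b \<in> slice (n + d_height l (d_kind_of b)) (d_gap l (d_kind_of b))}" for l n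
  proof (rule set_eqI)
    show "b \<in> d_col l n \<longleftrightarrow> b \<in> {b. d_index b \<in> slice (n + d_height l (d_kind_of b)) (d_gap l (d_kind_of b))}" for b
      by (cases b; cases l) (auto simp: blocks_below_def slice_def d_gap_def)
  qed
  show "l' = l" if "\<And>k. d_height l' k = d_height l k + d" for l' l d
    using that[of KZ] that[of KW] that[of KP] that[of KQ] by (cases l; cases l') simp_all
qed

lemma d_class_adds_iff:
  assumes "i \<in> Idx"
  shows "class_adds d_colour (\<lambda>i y y'. False) i (class_of d_col l) (class_of d_col l') \<longleftrightarrow>
    (U l, U l') \<in> d_arrows i"
  unfolding d.class_adds_iff[of "\<lambda>i y y'. False" i _ _ "\<lambda>i l l'. False", OF refl]
    ex_d_kind all_d_kind
  \<comment> \<open>The constant is \<open>- 1\<close> when the added block completes a pair of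
    rows, as from \<open>D0\<close> to \<open>D3b\<close> or \<open>D1\<close> to
    \<open>D2\<close>.\<close>
  using assms by (cases l; cases l') (auto simp: Idx_def d_arrows_def d_gap_def intro: exI[of _ "- 1"])

text \<open>Columns do not enter here: the tabulated counts are compared with iterated arrows of the
  graph.\<close>

lemma d_sig_eq_string_length:
  assumes "i \<in> Idx"
  shows "d_sig i l = (string_length (graph_e d_arrows i) (U l), string_length (graph_f d_arrows i) (U l))"
proof -
  have "string_length (graph_e d_arrows i) (U l) = fst (d_sig i l)"
    using assms by (intro string_length_eqI; cases l)
      (auto simp: Idx_def d_sig_def numeral_eq_Suc op_power_0 op_power_Suc graph_e_def d_arrows_def)
  moreover have "string_length (graph_f d_arrows i) (U l) = snd (d_sig i l)"
    using assms by (intro string_length_eqI; cases l)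
      (auto simp: Idx_def d_sig_def numeral_eq_Suc op_power_0 op_power_Suc graph_f_def d_arrows_def)
  ultimately show ?thesis by simp
qed

lemma psi_d_class: "psi (d_class l) = U l"
  by (simp add: psi_def d_class_def d.class_of_eq_iff)

lemma crystal_isomorphism_psi: "crystal_isomorphism C1 B1 psi"
  unfolding C1_def B1_def
proof (rule d.crystal_isomorphism_graph_crystal[where v = U])
  show "bij U" by (metis bijI' d_vertex.exhaust d_vertex.inject)
  show "psi (class_of d_col l) = U l" for l
    using psi_d_class by (simp add: d_class_def)
  show "single_valued (d_arrows i)" "single_valued ((d_arrows i)\<inverse>)" for i
    by (auto simp: single_valued_def d_arrows_def)
qed (simp_all only: d_class_adds_iff d_sig_eq_string_length)


section \<open>Type \<open>G\<^sub>2\<^sup>(\<^sup>1\<^sup>)\<close>\<close>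

datatype g_kind = LZ | LA | LB | LX | LY | LV

primrec g_kind_of :: "g_block \<Rightarrow> g_kind" where
  "g_kind_of (GZ n) = LZ"
| "g_kind_of (GA n) = LA"
| "g_kind_of (GB n) = LB"
| "g_kind_of (GX n) = LX"
| "g_kind_of (GY n) = LY"
| "g_kind_of (GV n) = LV"

primrec g_index :: "g_block \<Rightarrow> int" where
  "g_index (GZ n) = n"
| "g_index (GA n) = n"
| "g_index (GB n) = n"
| "g_index (GX n) = n"
| "g_index (GY n) = n"
| "g_index (GV n) = n"

primrec g_block_at :: "g_kind \<Rightarrow> int \<Rightarrow> g_block" where
  "g_block_at LZ = GZ"
| "g_block_at LA = GA"
| "g_block_at LB = GB"
| "g_block_at LX = GX"
| "g_block_at LY = GY"
| "g_block_at LV = GV"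

primrec g_kind_colour :: "g_kind \<Rightarrow> nat" where
  "g_kind_colour LZ = 0"
| "g_kind_colour LA = 2"
| "g_kind_colour LB = 2"
| "g_kind_colour LX = 1"
| "g_kind_colour LY = 1"
| "g_kind_colour LV = 2"

primrec g_height :: "g_label \<Rightarrow> g_kind \<Rightarrow> int" where
  "g_height G1 = case_g_kind 2 1 1 1 0 0"
| "g_height G2 = case_g_kind 2 1 1 1 1 0"
| "g_height G3 = case_g_kind 1 0 0 0 0 0"
| "g_height G4 = case_g_kind 1 1 0 0 0 0"
| "g_height G5 = case_g_kind 1 1 0 0 1 0"
| "g_height G6 = case_g_kind 1 1 1 0 0 0"
| "g_height G7 = case_g_kind 1 1 1 0 1 0"
| "g_height G7b = case_g_kind 1 1 0 0 1 1"
| "g_height G6b = case_g_kind 1 1 1 1 1 0"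
| "g_height G5b = case_g_kind 1 1 1 0 1 1"
| "g_height G4b = case_g_kind 0 0 0 0 0 0"
| "g_height G3b = case_g_kind 0 1 0 0 0 0"
| "g_height G2b = case_g_kind 0 1 1 0 0 0"
| "g_height G1b = case_g_kind 0 1 1 1 0 0"
| "g_height G0 = case_g_kind 1 1 1 1 0 0"

text \<open>As in the other type, this blocks the 1-additions from \<open>G6\<close> to
  \<open>G0\<close> and from \<open>G0\<close> to \<open>G6b\<close> that the heights would
  permit.\<close>

definition g_gap :: "g_label \<Rightarrow> g_kind \<Rightarrow> bool" where
  "g_gap l k \<longleftrightarrow> l = G0 \<and> k = LZ"

lemma all_g_kind: "(\<forall>k. P k) \<longleftrightarrow> P LZ \<and> P LA \<and> P LB \<and> P LX \<and> P LY \<and> P LV"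
  by (metis g_kind.exhaust)

lemma ex_g_kind: "(\<exists>k. P k) \<longleftrightarrow> P LZ \<or> P LA \<or> P LB \<or> P LX \<or> P LY \<or> P LV"
  by (metis g_kind.exhaust)

interpretation g: column_pattern g_kind_of g_index g_block_at g_height g_gap g_col g_colour g_kind_colour
proof
  show "g_kind_of (g_block_at k n) = k" for k n by (cases k) simp_all
  show "g_index (g_block_at k n) = n" for k n by (cases k) simp_all
  show "g_block_at (g_kind_of b) (g_index b) = b" for b by (cases b) simp_all
  show "g_colour b = g_kind_colour (g_kind_of b)" for b by (cases b) simp_all
  show "g_col l n = {b. g_index b \<in> slice (n + g_height l (g_kind_of b)) (g_gap l (g_kind_of b))}" for l n
  proof (rule set_eqI)
    show "b \<in> g_col l n \<longleftrightarrow> b \<in> {b. g_index b \<in> slice (n + g_height l (g_kind_of b)) (g_gap l (g_kind_of b))}" for b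
      by (cases b; cases l) (auto simp: blocks_below_def slice_def g_gap_def)
  qed
  show "l' = l" if "\<And>k. g_height l' k = g_height l k + d" for l' l d
    using that[of LZ] that[of LA] that[of LB] that[of LX] that[of LY] that[of LV]
    by (cases l; cases l') simp_all
qed

text \<open>Disjointness of the classes turns the convention into the condition on labels that
  \<open>class_adds_iff\<close> requires.\<close>

lemma g_ban_col: "g_ban i (g_col l n) (g_col l' m) \<longleftrightarrow> i = 2 \<and> (l = G7 \<or> l' = G7)"
  by (simp add: g_ban_def g_class_def g.col_in_class_of)

text \<open>The ban removes exactly the 2-additions from \<open>G5\<close> to \<open>G7\<close> and
  from \<open>G7\<close> to \<open>G5b\<close>. Otherwise \<open>G5\<close> would have two
  2-successors and \<open>G5b\<close> two 2-predecessors.\<close>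

lemma g_class_adds_iff:
  assumes "i \<in> Idx"
  shows "class_adds g_colour g_ban i (class_of g_col l) (class_of g_col l') \<longleftrightarrow>
    (V l, V l') \<in> g_arrows i"
  unfolding g.class_adds_iff[of g_ban i _ _ "\<lambda>i l l'. i = 2 \<and> (l = G7 \<or> l' = G7)", OF g_ban_col]
    ex_g_kind all_g_kind
  using assms by (cases l; cases l') (auto simp: Idx_def g_arrows_def g_gap_def intro: exI[of _ "- 1"])

lemma g_sig_eq_string_length:
  assumes "i \<in> Idx"
  shows "g_sig i l = (string_length (graph_e g_arrows i) (V l), string_length (graph_f g_arrows i) (V l))"
proof -
  have "string_length (graph_e g_arrows i) (V l) = fst (g_sig i l)"
    using assms by (intro string_length_eqI; cases l)
      (auto simp: Idx_def g_sig_def numeral_eq_Suc op_power_0 op_power_Suc graph_e_def g_arrows_def)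
  moreover have "string_length (graph_f g_arrows i) (V l) = snd (g_sig i l)"
    using assms by (intro string_length_eqI; cases l)
      (auto simp: Idx_def g_sig_def numeral_eq_Suc op_power_0 op_power_Suc graph_f_def g_arrows_def)
  ultimately show ?thesis by simp
qed

lemma psi'_g_class: "psi' (g_class l) = V l"
  by (simp add: psi'_def g_class_def g.class_of_eq_iff)

lemma crystal_isomorphism_psi': "crystal_isomorphism C1' B1' psi'"
  unfolding C1'_def B1'_def
proof (rule g.crystal_isomorphism_graph_crystal[where v = V])
  show "bij V" by (metis bijI' g_vertex.exhaust g_vertex.inject)
  show "psi' (class_of g_col l) = V l" for l
    using psi'_g_class by (simp add: g_class_def)
  show "single_valued (g_arrows i)" "single_valued ((g_arrows i)\<inverse>)" for i
    by (auto simp: single_valued_def g_arrows_def)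
qed (simp_all only: g_class_adds_iff g_sig_eq_string_length)

theorem proposition3p6:
  shows "((\<forall>l. psi (d_class l) = U l) \<and> crystal_isomorphism C1 B1 psi) \<and>
         ((\<forall>l. psi' (g_class l) = V l) \<and> crystal_isomorphism C1' B1' psi')"
  by (simp add: psi_d_class psi'_g_class crystal_isomorphism_psi crystal_isomorphism_psi')

end
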